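(* Let $C\ge 1$ be an integer, let $H=(L,F)$ be a finite directed graph in which every node has indegree at most $C$, and let $d\in\mathbb Z_{\ge0}$. Then there is a function $\tau:L\times\{0,1,\ldots,d\}\to\mathbb Z_{\ge0}$ such that: (1) for every $v\in L$, $\displaystyle\sum_{\substack{u\in L,\ 0\le r\le d\\ v\in B^+(u,r)}}\tau(u,r)=\sum_{i=0}^d C^i$; (2) for every $v\in L$, $\displaystyle\sum_{\substack{u\in L,\ 0\le r\le d\\ v\in \partial B^+(u,r)}}\tau(u,r)=C^d$; (3) $\tau(u,r)\le C^{d-r}$ for every $u\in L$ and $0\le r\le d$.
   Context: For nodes $u,v$ of $H$, $d_H(u,v)$ denotes the number of edges in a shortest directed path from $u$ to $v$ in $H$ ($\infty$ if none exists; $d_H(u,u)=0$). For $u\in L$ and $r\ge 0$, the directed ball is $B^+(u,r)=\{v\in L: d_H(u,v)\le r\}$ and its boundary is $\partial B^+(u,r)=\{v\in L: d_H(u,v)=r\}$. *)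

theory Defs
  imports "Graph_Theory.Graph_Theory" "HOL-Library.Extended_Nat"
begin

definition digraph_dist :: "('a, 'b) pre_digraph \<Rightarrow> 'a \<Rightarrow> 'a \<Rightarrow> enat" where
  "digraph_dist H u v = (INF p \<in> {p. pre_digraph.apath H u p v}. enat (length p))"

definition out_ball :: "('a, 'b) pre_digraph \<Rightarrow> 'a \<Rightarrow> nat \<Rightarrow> 'a set" where
  "out_ball H u r = {v \<in> verts H. digraph_dist H u v \<le> enat r}"

definition out_sphere :: "('a, 'b) pre_digraph \<Rightarrow> 'a \<Rightarrow> nat \<Rightarrow> 'a set" where
  "out_sphere H u r = {v \<in> verts H. digraph_dist H u v = enat r}"

lemma (in wf_digraph) digraph_dist_self:
  assumes "u \<in> verts G"
  shows "digraph_dist G u u = 0"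
proof -
  have "apath u [] u"
    using assms by (simp add: apath_def awalk_Nil_iff)
  then have "digraph_dist G u u \<le> enat (length ([] :: 'b list))"
    unfolding digraph_dist_def by (intro INF_lower) simp
  then show ?thesis
    by (simp add: zero_enat_def[symmetric])
qed

lemma (in wf_digraph) digraph_dist_unreachable:
  assumes "\<not> u \<rightarrow>\<^sup>* v"
  shows "digraph_dist G u v = \<infinity>"
proof -
  have "{p. apath u p v} = {}"
    using assms by (auto simp: reachable_apath)
  then show ?thesis
    unfolding digraph_dist_def by (simp add: top_enat_def)
qed

end

theory Submission
  imports Defs
begin

text \<open>
  Induction on \<open>d\<close>. Subtracting (2) from (1) leaves only the pairs \<open>(u, r)\<close> with
  \<open>v\<close> in the ball of radius \<open>r - 1\<close> around \<open>u\<close>, so a solution for \<open>d + 1\<close> arises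
  as the radius shift \<open>\<tau> u r = \<tau>' u (r - 1)\<close> of a solution \<open>\<tau>'\<close> for \<open>d\<close>, with \<open>\<tau> v 0\<close>
  being whatever (2) leaves over. This remainder is nonnegative: if \<open>v\<close> is at distance \<open>r + 1\<close>
  from \<open>u\<close>, some in-neighbour of \<open>v\<close> is at distance \<open>r\<close> from \<open>u\<close>, and each of the at most
  \<open>C\<close> in-neighbours receives exactly \<open>C ^ d\<close> by (2) for \<open>\<tau>'\<close>.
\<close>

text \<open>Overlaps are counted once on the left and repeatedly on the right.\<close>

lemma sum_UN_le_sum_sum:
  fixes f :: "'b \<Rightarrow> nat"
  assumes "finite I" "\<And>i. i \<in> I \<Longrightarrow> finite (A i)"
  shows "sum f (\<Union>i\<in>I. A i) \<le> (\<Sum>i\<in>I. sum f (A i))"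
  using assms
proof (induction I rule: finite_induct)
  case (insert i I)
  have "sum f (A i \<union> (\<Union>i\<in>I. A i)) \<le> sum f (A i) + sum f (\<Union>i\<in>I. A i)"
    using insert by (subst sum.union_inter[symmetric]) auto
  also have "\<dots> \<le> sum f (A i) + (\<Sum>i\<in>I. sum f (A i))"
    using insert by simp
  finally show ?case
    using insert by simp
qed simp

section \<open>Directed distance and walks\<close>

context wf_digraph
begin

text \<open>Each recursion step deletes a cycle, which only shortens the walk. Since
  \<open>digraph_dist\<close> ranges over simple paths, this lets arbitrary walks bound
  distances.\<close>

lemma length_awalk_to_apath_le:
  assumes "awalk u p v"
  shows "length (awalk_to_apath p) \<le> length p"
  using assms
proof (induct rule: awalk_to_apath_induct)
  case (path p)
  then show ?case
    by (auto simp: awalk_to_apath.simps)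
next
  case (decomp p q r s)
  have "length (awalk_to_apath (q @ s)) \<le> length p"
    using decomp by (auto elim!: awalk_cyc_decompE)
  then show ?case
    using decomp step_awalk_to_apath[of u p v q r s] by simp
qed

lemma digraph_dist_le_length:
  assumes "awalk u p v"
  shows "digraph_dist G u v \<le> enat (length p)"
proof -
  have "digraph_dist G u v \<le> enat (length (awalk_to_apath p))"
    unfolding digraph_dist_def using apath_awalk_to_apath[OF assms] by (intro INF_lower) simp
  also have "\<dots> \<le> enat (length p)"
    using length_awalk_to_apath_le[OF assms] by simp
  finally show ?thesis .
qed

text \<open>Without any path the infimum would be infinite; otherwise the well-ordering of
  \<open>enat\<close> makes it attained.\<close>

lemma digraph_dist_eq_enatE:
  assumes "digraph_dist G u v = enat n"
  obtains p where "awalk u p v" "length p = n"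
proof -
  let ?L = "(\<lambda>p. enat (length p)) ` {p. apath u p v}"
  have "?L \<noteq> {}"
    using assms unfolding digraph_dist_def by (metis Inf_empty top_enat_def enat.distinct(1))
  then have "Inf ?L \<in> ?L"
    by (meson wellorder_InfI ex_in_conv)
  then show ?thesis
    using assms that by (auto simp: digraph_dist_def intro: awalkI_apath)
qed

lemma digraph_dist_eq_0_iff:
  assumes "u \<in> verts G"
  shows "digraph_dist G u v = 0 \<longleftrightarrow> u = v"
proof
  assume "digraph_dist G u v = 0"
  then show "u = v"
    by (auto simp: zero_enat_def awalk_Nil_iff elim: digraph_dist_eq_enatE)
qed (use assms digraph_dist_self in auto)

text \<open>Cutting the last arc off a shortest walk leaves a walk of length \<open>k\<close>. Were
  its end any nearer to \<open>u\<close>, putting the arc back would reach \<open>v\<close> in fewer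
  than \<open>Suc k\<close> steps.\<close>

lemma digraph_dist_SucE:
  assumes "digraph_dist G u v = enat (Suc k)"
  obtains e where "e \<in> in_arcs G v" "digraph_dist G u (tail G e) = enat k"
proof -
  obtain p where p: "awalk u p v" "length p = Suc k"
    using assms by (rule digraph_dist_eq_enatE)
  then obtain q e where "p = q @ [e]"
    by (metis length_Suc_conv_rev)
  with p have q: "awalk u q (tail G e)" "length q = k" and e: "e \<in> arcs G" "head G e = v"
    by (auto simp: awalk_simps)
  have le: "digraph_dist G u (tail G e) \<le> enat k"
    using digraph_dist_le_length[OF q(1)] q(2) by simp
  then obtain m where m: "digraph_dist G u (tail G e) = enat m" "m \<le> k"
    by (cases "digraph_dist G u (tail G e)") auto
  then obtain q' where q': "awalk u q' (tail G e)" "length q' = m"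
    by (auto elim: digraph_dist_eq_enatE)
  have "awalk u (q' @ [e]) v"
    using q'(1) e by (intro awalk_appendI[OF q'(1)]) (auto simp: awalk_simps)
  from digraph_dist_le_length[OF this] have "k \<le> m"
    using assms q'(2) by simp
  with m e that show ?thesis
    by auto
qed

end

section \<open>Index sets of the two sums and their recursion in \<open>d\<close>\<close>

context fin_digraph
begin

definition ball_pairs :: "nat \<Rightarrow> 'a \<Rightarrow> ('a \<times> nat) set" where
  "ball_pairs d v = {(u, r). u \<in> verts G \<and> r \<in> {0..d} \<and> v \<in> out_ball G u r}"

definition sphere_pairs :: "nat \<Rightarrow> 'a \<Rightarrow> ('a \<times> nat) set" where
  "sphere_pairs d v = {(u, r). u \<in> verts G \<and> r \<in> {0..d} \<and> v \<in> out_sphere G u r}"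

text \<open>The pairs of positive radius in \<open>sphere_pairs (Suc d) v\<close>, with the radius
  lowered by one so that weights for \<open>d\<close> apply to them.\<close>

definition next_sphere_pairs :: "nat \<Rightarrow> 'a \<Rightarrow> ('a \<times> nat) set" where
  "next_sphere_pairs d v = {(u, r). u \<in> verts G \<and> r \<in> {0..d} \<and> v \<in> out_sphere G u (Suc r)}"

lemma finite_ball_pairs: "finite (ball_pairs d v)"
  by (rule finite_subset[of _ "verts G \<times> {0..d}"]) (auto simp: ball_pairs_def)

lemma finite_sphere_pairs: "finite (sphere_pairs d v)"
  by (rule finite_subset[of _ "verts G \<times> {0..d}"]) (auto simp: sphere_pairs_def)

lemma finite_next_sphere_pairs: "finite (next_sphere_pairs d v)"
  by (rule finite_subset[of _ "verts G \<times> {0..d}"]) (auto simp: next_sphere_pairs_def)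

lemma sphere_pairs_0:
  assumes "v \<in> verts G"
  shows "sphere_pairs 0 v = {(v, 0)}"
  using assms
  by (auto simp: sphere_pairs_def out_sphere_def digraph_dist_eq_0_iff zero_enat_def[symmetric])

lemma ball_pairs_0:
  assumes "v \<in> verts G"
  shows "ball_pairs 0 v = {(v, 0)}"
  using assms
  by (auto simp: ball_pairs_def out_ball_def digraph_dist_eq_0_iff zero_enat_def[symmetric])

lemma sphere_pairs_Suc:
  assumes "v \<in> verts G"
  shows "sphere_pairs (Suc d) v = insert (v, 0) (map_prod id Suc ` next_sphere_pairs d v)"
    (is "?L = ?R")
proof (intro set_eqI)
  fix x :: "'a \<times> nat"
  obtain u r where x: "x = (u, r)"
    by (cases x)
  show "x \<in> ?L \<longleftrightarrow> x \<in> ?R"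
    using assms digraph_dist_eq_0_iff[of u v] unfolding x
    by (cases r)
      (auto simp: sphere_pairs_def next_sphere_pairs_def out_sphere_def zero_enat_def[symmetric]
        image_iff)
qed

text \<open>A distance at most \<open>r\<close> either equals \<open>r\<close> or is at most
  \<open>r - 1\<close>: the subtraction of (2) from (1) at the level of index sets.\<close>

lemma ball_pairs_Suc:
  "ball_pairs (Suc d) v = sphere_pairs (Suc d) v \<union> map_prod id Suc ` ball_pairs d v"
    (is "?L = ?R")
proof (intro set_eqI)
  fix x :: "'a \<times> nat"
  obtain u r where x: "x = (u, r)"
    by (cases x)
  show "x \<in> ?L \<longleftrightarrow> x \<in> ?R"
    unfolding x by (cases r; cases "digraph_dist G u v")
      (auto simp: ball_pairs_def sphere_pairs_def out_ball_def out_sphere_def zero_enat_def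
        image_iff)
qed

lemma sphere_pairs_disjoint_Suc_ball_pairs:
  "sphere_pairs (Suc d) v \<inter> map_prod id Suc ` ball_pairs d v = {}"
  by (auto simp: ball_pairs_def sphere_pairs_def out_ball_def out_sphere_def)

lemma next_sphere_pairs_subset:
  "next_sphere_pairs d v \<subseteq> (\<Union>w\<in>tail G ` in_arcs G v. sphere_pairs d w)"
proof clarify
  fix u r
  assume ur: "(u, r) \<in> next_sphere_pairs d v"
  then have "digraph_dist G u v = enat (Suc r)"
    by (simp add: next_sphere_pairs_def out_sphere_def)
  then obtain e where "e \<in> in_arcs G v" "digraph_dist G u (tail G e) = enat r"
    by (rule digraph_dist_SucE)
  with ur show "(u, r) \<in> (\<Union>w\<in>tail G ` in_arcs G v. sphere_pairs d w)"
    by (auto simp: next_sphere_pairs_def sphere_pairs_def out_sphere_def)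
qed

text \<open>The set of tails has at most \<open>in_degree G v\<close> elements, as parallel arcs
  share a tail.\<close>

lemma sum_next_sphere_pairs_le:
  fixes f :: "'a \<times> nat \<Rightarrow> nat"
  assumes "in_degree G v \<le> C" and "\<And>w. w \<in> verts G \<Longrightarrow> sum f (sphere_pairs d w) = M"
  shows "sum f (next_sphere_pairs d v) \<le> C * M"
proof -
  let ?N = "tail G ` in_arcs G v"
  have fin: "finite ?N"
    by auto
  have "sum f (next_sphere_pairs d v) \<le> sum f (\<Union>w\<in>?N. sphere_pairs d w)"
    using fin by (intro sum_mono2 next_sphere_pairs_subset) (auto simp: finite_sphere_pairs)
  also have "\<dots> \<le> (\<Sum>w\<in>?N. sum f (sphere_pairs d w))"
    using fin by (intro sum_UN_le_sum_sum) (auto simp: finite_sphere_pairs)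
  also have "\<dots> = (\<Sum>w\<in>?N. M)"
    using assms(2) by (intro sum.cong) auto
  also have "\<dots> = card ?N * M"
    by simp
  also have "card ?N \<le> C"
    using assms(1) card_image_le[OF finite_in_arcs, of "tail G" v]
    by (simp add: in_degree_def)
  finally show ?thesis
    by simp
qed

text \<open>Taking pairs as arguments turns the radius shift into reindexing along
  \<open>map_prod id Suc\<close>.\<close>

lemma exists_ball_weights:
  assumes indeg: "\<And>v. v \<in> verts G \<Longrightarrow> in_degree G v \<le> C"
  shows "\<exists>\<tau> :: 'a \<times> nat \<Rightarrow> nat.
    (\<forall>v \<in> verts G. sum \<tau> (ball_pairs d v) = (\<Sum>i = 0..d. C ^ i)) \<and>
    (\<forall>v \<in> verts G. sum \<tau> (sphere_pairs d v) = C ^ d) \<and>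
    (\<forall>u \<in> verts G. \<forall>r \<in> {0..d}. \<tau> (u, r) \<le> C ^ (d - r))"
proof (induction d)
  case 0
  show ?case
    by (rule exI[of _ "\<lambda>_. 1"]) (simp add: ball_pairs_0 sphere_pairs_0)
next
  case (Suc d)
  then obtain \<tau>' :: "'a \<times> nat \<Rightarrow> nat" where
    ball: "\<And>v. v \<in> verts G \<Longrightarrow> sum \<tau>' (ball_pairs d v) = (\<Sum>i = 0..d. C ^ i)" and
    sphere: "\<And>v. v \<in> verts G \<Longrightarrow> sum \<tau>' (sphere_pairs d v) = C ^ d" and
    bound: "\<And>u r. u \<in> verts G \<Longrightarrow> r \<le> d \<Longrightarrow> \<tau>' (u, r) \<le> C ^ (d - r)"
    by (metis atLeastAtMost_iff le0)
  \<comment> \<open>The subtraction is truncated, so (2) at \<open>v\<close> needs the subtracted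
    sum to be at most \<open>C ^ Suc d\<close>.\<close>
  define \<tau> where "\<tau> = (\<lambda>(u, r). case r of
      0 \<Rightarrow> C ^ Suc d - sum \<tau>' (next_sphere_pairs d u) | Suc r' \<Rightarrow> \<tau>' (u, r'))"
  have shift: "sum \<tau> (map_prod id Suc ` A) = sum \<tau>' A" for A
    by (subst sum.reindex) (auto simp: \<tau>_def inj_on_def intro!: sum.cong)
  have sphere': "sum \<tau> (sphere_pairs (Suc d) v) = C ^ Suc d" if v: "v \<in> verts G" for v
  proof -
    \<comment> \<open>This makes the truncated subtraction in \<open>\<tau> (v, 0)\<close>
      exact.\<close>
    have "sum \<tau>' (next_sphere_pairs d v) \<le> C ^ Suc d"
      using sum_next_sphere_pairs_le[OF indeg[OF v] sphere] by simp
    moreover have "sum \<tau> (sphere_pairs (Suc d) v) = \<tau> (v, 0) + sum \<tau>' (next_sphere_pairs d v)"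
      by (subst sphere_pairs_Suc[OF v], subst sum.insert)
        (auto simp: finite_next_sphere_pairs shift)
    ultimately show ?thesis
      by (simp add: \<tau>_def)
  qed
  have "sum \<tau> (ball_pairs (Suc d) v) = (\<Sum>i = 0..Suc d. C ^ i)" if v: "v \<in> verts G" for v
  proof -
    have "sum \<tau> (ball_pairs (Suc d) v) = sum \<tau> (sphere_pairs (Suc d) v) + sum \<tau>' (ball_pairs d v)"
      unfolding ball_pairs_Suc
      by (subst sum.union_disjoint)
        (auto simp: finite_sphere_pairs finite_ball_pairs shift sphere_pairs_disjoint_Suc_ball_pairs)
    then show ?thesis
      using sphere' ball v by simp
  qed
  \<comment> \<open>At radius 0 a difference from \<open>C ^ Suc d\<close> cannot exceed it; at
    \<open>Suc r'\<close> the exponent \<open>Suc d - Suc r'\<close> is the old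
    \<open>d - r'\<close>.\<close>
  moreover have "\<tau> (u, r) \<le> C ^ (Suc d - r)" if "u \<in> verts G" "r \<in> {0..Suc d}" for u r
    using that bound by (cases r) (auto simp: \<tau>_def)
  ultimately show ?case
    using sphere' by blast
qed

end

theorem theorem5:
  fixes H :: "('a, 'b) pre_digraph" and C d :: nat
  assumes "C \<ge> 1"
    and "fin_digraph H"
    and "\<forall>v \<in> verts H. in_degree H v \<le> C"
  shows "\<exists>\<tau> :: 'a \<Rightarrow> nat \<Rightarrow> nat.
    (\<forall>v \<in> verts H.
      (\<Sum>(u, r) \<in> {(u, r). u \<in> verts H \<and> r \<in> {0..d} \<and> v \<in> out_ball H u r}. \<tau> u r)
        = (\<Sum>i = 0..d. C ^ i)) \<and>
    (\<forall>v \<in> verts H.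
      (\<Sum>(u, r) \<in> {(u, r). u \<in> verts H \<and> r \<in> {0..d} \<and> v \<in> out_sphere H u r}. \<tau> u r)
        = C ^ d) \<and>
    (\<forall>u \<in> verts H. \<forall>r \<in> {0..d}. \<tau> u r \<le> C ^ (d - r))"
proof -
  interpret fin_digraph H
    by (rule assms(2))
  obtain \<tau> :: "'a \<times> nat \<Rightarrow> nat" where
    "\<forall>v \<in> verts H. sum \<tau> (ball_pairs d v) = (\<Sum>i = 0..d. C ^ i)"
    "\<forall>v \<in> verts H. sum \<tau> (sphere_pairs d v) = C ^ d"
    "\<forall>u \<in> verts H. \<forall>r \<in> {0..d}. \<tau> (u, r) \<le> C ^ (d - r)"
    using exists_ball_weights[of C d] assms(3) by blast
  then show ?thesis
    unfolding ball_pairs_def sphere_pairs_def by (intro exI[of _ "curry \<tau>"]) simp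
qed

end
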